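(* Let $\Delta=4x^6+4x^5-3x^4-4x^3-2x^2+1$ and $$r=\frac{1-2x^3-x^2-\sqrt\Delta}{2x^2},\qquad s=\frac{1-2x^3-x^2+\sqrt\Delta}{2x^2}.$$ Count partial packing paths by number of steps (variable $x$) and final height (variable $u$), with $F^0,F^1,G^0,G^1,H^0,H^1$ the generating functions of those ending with $U,\overline U,D,\overline D,F,\overline F$ respectively (the empty path being counted in $F^0$). Then $$F^0(u)=1-\frac{u(xs+1)}{(x+1)(u^2-s)},\qquad F^1(u)=\frac{-u^2}{u^2-s},\qquad G^0(u)=\frac{-2x^2-(1+r)x}{(1+x)(u^2-s)},$$ $$G^1(u)=\frac{-u(r+x)}{(1+x)(u^2-s)},\qquad H^0(u)=\frac{-u}{u^2-s},\qquad H^1(u)=\frac{u(-2x^2-(1+r)x)}{(1+x)(u^2-s)}.$$ Moreover, the bivariate generating function $S(x,u)$, in which the coefficient of $x^nu^k$ is the number of partial packing paths with $n$ steps ending at height $k$, satisfies $$S(x,u)=\frac{u(-2x^2-x(r+2)-1)-sx-1}{x(1+x)(u^2-s)}.$$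
   Context: Consider the hexagonal packing of the plane by circles of radius $2$ with centers $(2+4i+2j,\,2\sqrt3\,j)$, $i,j\in\mathbb Z$; the origin is the tangency point of two horizontally adjacent circles. The tangency points cut every circle into six arcs. Traversed from left to right these give six types of steps (angles measured on the circle carrying the arc): $U$ from $180^\circ$ to $120^\circ$ (displacement $(1,\sqrt3)$), $F$ from $120^\circ$ to $60^\circ$ (displacement $(2,0)$), $D$ from $60^\circ$ to $0^\circ$ (displacement $(1,-\sqrt3)$), $\overline U$ from $300^\circ$ to $360^\circ$ (displacement $(1,\sqrt3)$), $\overline F$ from $240^\circ$ to $300^\circ$ (displacement $(2,0)$), $\overline D$ from $180^\circ$ to $240^\circ$ (displacement $(1,-\sqrt3)$). A path in the packing starts at the origin, is a concatenation of such arcs of circles of the packing, each starting where the previous one ends, and stays in the quarter plane $x,y\ge 0$. Equivalently, it is a word in $\{U,F,D,\overline U,\overline F,\overline D\}$ whose first step (if any) is $U$, in which $U$ or $\overline F$ can only be followed by $F$ or $\overline U$; $F$ or $\overline D$ only by $\overline F$ or $D$; $\overline U$ or $D$ only by $U$ or $\overline D$; and which never goes below ordinate $0$. A packing path is such a path ending on the $x$-axis; a partial packing path is any prefix of a packing path. The empty path is allowed. The number of steps of a path is its number of arcs. The (final) height of a path is the integer $k$ such that its endpoint has ordinate $k\sqrt3$. For $k\ge 0$ let $f_k^0,f_k^1,g_k^0,g_k^1,h_k^0,h_k^1$ be the generating functions, in the variable $x$ marking the number of steps, of the partial packing paths ending at height $k$ whose last step is $U,\overline U,D,\overline D,F,\overline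 F$ respectively; by convention $f_0^0=1$ (empty path). Set $F^i(u)=\sum_{k\ge0}f_k^iu^k$, $G^i(u)=\sum_{k\ge0}g_k^iu^k$, $H^i(u)=\sum_{k\ge0}h_k^iu^k$ for $i\in\{0,1\}$, and $S(x,u)=F^0(u)+F^1(u)+G^0(u)+G^1(u)+H^0(u)+H^1(u)$. All identities are between formal series, the square root having constant term $1$ (so $r$ is a power series in $x$ with zero constant term and $rs=1$). *)

theory Defs
  imports Complex_Main
    "HOL-Library.Sublist"
    "HOL-Computational_Algebra.Formal_Laurent_Series"
begin

(* The plane is identified with the complex numbers. Ub, Fb, Db are the barred steps. *)

datatype step = U | F | D | Ub | Fb | Db

fun start_angle :: "step \<Rightarrow> real" where
  "start_angle U = pi"
| "start_angle F = 2 * pi / 3"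
| "start_angle D = pi / 3"
| "start_angle Ub = 5 * pi / 3"
| "start_angle Fb = 4 * pi / 3"
| "start_angle Db = pi"

fun end_angle :: "step \<Rightarrow> real" where
  "end_angle U = 2 * pi / 3"
| "end_angle F = pi / 3"
| "end_angle D = 0"
| "end_angle Ub = 2 * pi"
| "end_angle Fb = 5 * pi / 3"
| "end_angle Db = 4 * pi / 3"

(* Arc i j t is the arc of type t on the circle with centre (2 + 4i + 2j, 2 sqrt 3 j). *)
datatype arc = Arc (arc_i: int) (arc_j: int) (arc_type: step)

definition centre :: "int \<Rightarrow> int \<Rightarrow> complex" where
  "centre i j = Complex (2 + 4 * of_int i + 2 * of_int j) (2 * sqrt 3 * of_int j)"

definition circle_point :: "arc \<Rightarrow> real \<Rightarrow> complex" where
  "circle_point a \<theta> = centre (arc_i a) (arc_j a) + 2 * cis \<theta>"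

definition arc_start :: "arc \<Rightarrow> complex" where
  "arc_start a = circle_point a (start_angle (arc_type a))"

definition arc_end :: "arc \<Rightarrow> complex" where
  "arc_end a = circle_point a (end_angle (arc_type a))"

(* U, F, D are traversed clockwise, so their angles decrease: hence min and max. *)
definition arc_points :: "arc \<Rightarrow> complex set" where
  "arc_points a = circle_point a `
     {min (start_angle (arc_type a)) (end_angle (arc_type a)) ..
      max (start_angle (arc_type a)) (end_angle (arc_type a))}"

definition quarter_plane :: "complex set" where
  "quarter_plane = {z. Re z \<ge> 0 \<and> Im z \<ge> 0}"

definition is_path :: "arc list \<Rightarrow> bool" where
  "is_path w \<longleftrightarrow>
     (w \<noteq> [] \<longrightarrow> arc_start (hd w) = 0) \<and>
     (\<forall>m. Suc m < length w \<longrightarrow> arc_end (w ! m) = arc_start (w ! Suc m)) \<and>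
     (\<forall>a \<in> set w. arc_points a \<subseteq> quarter_plane)"

definition path_end :: "arc list \<Rightarrow> complex" where
  "path_end w = (if w = [] then 0 else arc_end (last w))"

definition packing_path :: "arc list \<Rightarrow> bool" where
  "packing_path w \<longleftrightarrow> is_path w \<and> Im (path_end w) = 0"

definition partial_packing_path :: "arc list \<Rightarrow> bool" where
  "partial_packing_path w \<longleftrightarrow> (\<exists>v. packing_path v \<and> prefix w v)"

definition has_height :: "arc list \<Rightarrow> nat \<Rightarrow> bool" where
  "has_height w k \<longleftrightarrow> Im (path_end w) = real k * sqrt 3"

(* The empty path is counted among the paths ending with U. *)
definition last_step :: "arc list \<Rightarrow> step" where
  "last_step w = (if w = [] then U else arc_type (last w))"

definition partial_paths :: "nat \<Rightarrow> nat \<Rightarrow> arc list set" where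
  "partial_paths n k = {w. partial_packing_path w \<and> length w = n \<and> has_height w k}"

definition gf_height :: "step \<Rightarrow> nat \<Rightarrow> real fps" where
  "gf_height t k = Abs_fps (\<lambda>n. of_nat (card {w \<in> partial_paths n k. last_step w = t}))"

(* Identities live in R((x))[[u]]: s has a pole at x = 0, while u^2 - s is
   invertible because its constant term in u is the nonzero Laurent series -s. *)
definition GF :: "step \<Rightarrow> real fls fps" where
  "GF t = Abs_fps (\<lambda>k. fps_to_fls (gf_height t k))"

definition S :: "real fls fps" where
  "S = GF U + GF Ub + GF D + GF Db + GF F + GF Fb"

definition Delta :: "real fps" where
  "Delta = 4 * fps_X ^ 6 + 4 * fps_X ^ 5 - 3 * fps_X ^ 4 - 4 * fps_X ^ 3 - 2 * fps_X ^ 2 + 1"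

(* fps_radical root 2 selects the square root with constant term root 2 1 = 1. *)
definition sqrt_Delta :: "real fls" where
  "sqrt_Delta = fps_to_fls (fps_radical root 2 Delta)"

definition r_series :: "real fls" where
  "r_series = (1 - 2 * fls_X ^ 3 - fls_X ^ 2 - sqrt_Delta) / (2 * fls_X ^ 2)"

definition s_series :: "real fls" where
  "s_series = (1 - 2 * fls_X ^ 3 - fls_X ^ 2 + sqrt_Delta) / (2 * fls_X ^ 2)"

end

theory Submission
  imports Defs
begin

text \<open>A quarter-plane path is determined by its word of steps, and it stays in the quarter plane iff
  its height never becomes negative; every such path can be completed to a packing path by descending
  to the axis. Removing the last arc therefore gives linear recurrences for the numbers of paths,
  which determine these numbers by induction on the number of steps. The expansions in \<open>u\<close> of the
  claimed fractions have coefficients \<open>r ^ m\<close> times a factor depending only on the last step,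
  and these satisfy the recurrences because \<open>x^2 r^2 - (1 - 2x^3 - x^2) r + x^2 = 0\<close>.\<close>

section \<open>Arcs in integer coordinates and the transition rules\<close>

lemma sin_cos_240: "cos (4 * pi / 3) = -1/2" "sin (4 * pi / 3) = - sqrt 3 / 2"
  using cos_periodic_pi[of "pi/3"] sin_periodic_pi[of "pi/3"]
  by (simp_all add: cos_60 sin_60 algebra_simps)

lemma sin_cos_300: "cos (5 * pi / 3) = 1/2" "sin (5 * pi / 3) = - sqrt 3 / 2"
  using cos_2pi_minus[of "pi/3"] sin_2pi_minus[of "pi/3"]
  by (simp_all add: cos_60 sin_60 algebra_simps)

lemma sin_cos_120: "cos (2 * pi / 3) = -1/2" "sin (2 * pi / 3) = sqrt 3 / 2"
  using cos_120 sin_120 by simp_all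

lemma arc_start_simps [simp]:
  "arc_start (Arc i j U) = Complex (of_int (4 * i + 2 * j)) (of_int (2 * j) * sqrt 3)"
  "arc_start (Arc i j F) = Complex (of_int (4 * i + 2 * j + 1)) (of_int (2 * j + 1) * sqrt 3)"
  "arc_start (Arc i j D) = Complex (of_int (4 * i + 2 * j + 3)) (of_int (2 * j + 1) * sqrt 3)"
  "arc_start (Arc i j Ub) = Complex (of_int (4 * i + 2 * j + 3)) (of_int (2 * j - 1) * sqrt 3)"
  "arc_start (Arc i j Fb) = Complex (of_int (4 * i + 2 * j + 1)) (of_int (2 * j - 1) * sqrt 3)"
  "arc_start (Arc i j Db) = Complex (of_int (4 * i + 2 * j)) (of_int (2 * j) * sqrt 3)"
  by (simp_all add: arc_start_def circle_point_def centre_def complex_eq_iff cos_60 sin_60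
        sin_cos_120 sin_cos_240 sin_cos_300)
    (simp_all add: algebra_simps)

lemma arc_end_simps [simp]:
  "arc_end (Arc i j U) = Complex (of_int (4 * i + 2 * j + 1)) (of_int (2 * j + 1) * sqrt 3)"
  "arc_end (Arc i j F) = Complex (of_int (4 * i + 2 * j + 3)) (of_int (2 * j + 1) * sqrt 3)"
  "arc_end (Arc i j D) = Complex (of_int (4 * i + 2 * j + 4)) (of_int (2 * j) * sqrt 3)"
  "arc_end (Arc i j Ub) = Complex (of_int (4 * i + 2 * j + 4)) (of_int (2 * j) * sqrt 3)"
  "arc_end (Arc i j Fb) = Complex (of_int (4 * i + 2 * j + 3)) (of_int (2 * j - 1) * sqrt 3)"
  "arc_end (Arc i j Db) = Complex (of_int (4 * i + 2 * j + 1)) (of_int (2 * j - 1) * sqrt 3)"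
  by (simp_all add: arc_end_def circle_point_def centre_def complex_eq_iff cos_60 sin_60
        sin_cos_120 sin_cos_240 sin_cos_300)
    (simp_all add: algebra_simps)

fun follows :: "step \<Rightarrow> step \<Rightarrow> bool" where
  "follows U t = (t = F \<or> t = Ub)"
| "follows Fb t = (t = F \<or> t = Ub)"
| "follows F t = (t = Fb \<or> t = D)"
| "follows Db t = (t = Fb \<or> t = D)"
| "follows Ub t = (t = U \<or> t = Db)"
| "follows D t = (t = U \<or> t = Db)"

fun height_change :: "step \<Rightarrow> int" where
  "height_change U = 1"
| "height_change Ub = 1"
| "height_change F = 0"
| "height_change Fb = 0"
| "height_change D = -1"
| "height_change Db = -1"

text \<open>For a fixed type the start is a fixed translate of the centre, and centres determine
  \<open>i\<close> and \<open>j\<close>.\<close>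

lemma arc_start_inject:
  assumes "arc_start a = arc_start b" "arc_type a = arc_type b"
  shows "a = b"
  using assms by (cases a; cases b; cases "arc_type a") (auto simp flip: of_int_add of_int_mult)

lemma complex_grid_eq_iff:
  "Complex (of_int a) (of_int b * sqrt 3) = Complex (of_int c) (of_int d * sqrt 3) \<longleftrightarrow> a = c \<and> b = d"
  by auto

text \<open>If \<open>b\<close> ends at abscissa \<open>X\<close> and height \<open>Y\<close>, the
  parity of \<open>Y\<close> and the residue of \<open>X - Y\<close> modulo 4 decide which types can
  start there. Three classes of tangency points arise, each with two outgoing types.\<close>

lemma ex_arc_from_iff:
  "(\<exists>a. arc_type a = t \<and> arc_start a = arc_end b) \<longleftrightarrow> follows (arc_type b) t"
proof -
  obtain i j t' where b: "b = Arc i j t'" by (cases b)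
  have "(\<exists>a. arc_type a = t \<and> arc_start a = arc_end b) \<longleftrightarrow> (\<exists>k l. arc_start (Arc k l t) = arc_end b)"
    by (metis arc.collapse arc.sel(3))
  also have "\<dots> \<longleftrightarrow> follows t' t"
    unfolding b
    by (cases t'; cases t; simp only: arc_start_simps arc_end_simps complex_grid_eq_iff follows.simps
        step.distinct simp_thms; presburger)
  finally show ?thesis by (simp add: b)
qed

lemma Im_arc_end: "Im (arc_end a) = Im (arc_start a) + of_int (height_change (arc_type a)) * sqrt 3"
  by (cases a; cases "arc_type a") (auto simp: algebra_simps)

section \<open>Containment of arcs in the quarter plane\<close>

lemma cos_arc_ge:
  assumes "min (start_angle t) (end_angle t) \<le> \<theta>" "\<theta> \<le> max (start_angle t) (end_angle t)"
  shows "cos (start_angle t) \<le> cos \<theta>"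
\<comment> \<open>On these arcs the angle decreases within \<open>[0, pi]\<close>, where cosine is
  decreasing, so the start is the leftmost point.\<close>
proof (cases "t \<in> {U, F, D}")
  case True
  have "0 \<le> \<theta>" "\<theta> \<le> start_angle t" "start_angle t \<le> pi"
    using assms True by (auto simp: min_def max_def split: if_splits; insert pi_gt_zero; linarith)+
  then show ?thesis by (intro cos_monotone_0_pi_le)
next
  case False
  \<comment> \<open>Reflection in the horizontal axis brings the barred arcs back to
    \<open>[0, pi]\<close>.\<close>
  then have "0 \<le> 2 * pi - \<theta>" "2 * pi - \<theta> \<le> 2 * pi - start_angle t" "2 * pi - start_angle t \<le> pi"
    using assms by (cases t; auto simp: min_def max_def split: if_splits; insert pi_gt_zero; linarith)+
  then have "cos (2 * pi - start_angle t) \<le> cos (2 * pi - \<theta>)" by (intro cos_monotone_0_pi_le)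
  then show ?thesis by simp
qed

text \<open>Barred arcs lie in the lower half of their circle. If their endpoints have nonnegative
  ordinate, the centre has ordinate at least \<open>2 * sqrt 3\<close> by integrality, which exceeds the radius.\<close>

lemma arc_points_subset_quarter_plane_iff:
  "arc_points a \<subseteq> quarter_plane \<longleftrightarrow> arc_start a \<in> quarter_plane \<and> 0 \<le> Im (arc_end a)"
proof
  assume *: "arc_points a \<subseteq> quarter_plane"
  have "arc_start a \<in> arc_points a" "arc_end a \<in> arc_points a"
    by (auto simp: arc_start_def arc_end_def arc_points_def)
  with * show "arc_start a \<in> quarter_plane \<and> 0 \<le> Im (arc_end a)"
    by (auto simp: quarter_plane_def)
next
  assume *: "arc_start a \<in> quarter_plane \<and> 0 \<le> Im (arc_end a)"
  obtain i j t where a: "a = Arc i j t" by (cases a)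
  show "arc_points a \<subseteq> quarter_plane"
  proof
    fix z assume "z \<in> arc_points a"
    then obtain \<theta> where z: "z = circle_point a \<theta>"
      and \<theta>: "min (start_angle t) (end_angle t) \<le> \<theta>" "\<theta> \<le> max (start_angle t) (end_angle t)"
      by (auto simp: arc_points_def a)
    have "Re (arc_start a) \<le> Re z"
      using cos_arc_ge[OF \<theta>] by (simp add: z a arc_start_def circle_point_def)
    moreover have "0 \<le> Im z"
    proof (cases "t \<in> {U, F, D}")
      case True
      have "0 \<le> \<theta>" "\<theta> \<le> pi"
        using \<theta> True by (auto simp: min_def max_def split: if_splits; insert pi_gt_zero; linarith)+
      then have "0 \<le> sin \<theta>" by (rule sin_ge_zero)
      moreover have "0 \<le> j"
        using * True by (auto simp: a quarter_plane_def zero_le_mult_iff simp flip: of_int_mult of_int_add)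
      ultimately show ?thesis by (simp add: z a circle_point_def centre_def)
    next
      case False
      then have "0 \<le> (of_int (2 * j - 1) :: real)"
        using * by (cases t) (simp_all add: a quarter_plane_def zero_le_mult_iff)
      then have "1 \<le> j" by linarith
      then have "1 \<le> sqrt 3 * of_int j" using mult_mono[of 1 "sqrt 3" 1 "of_int j"] by simp
      then have "0 \<le> 2 * (sqrt 3 * of_int j) + 2 * sin \<theta>" using sin_ge_minus_one[of \<theta>] by linarith
      then show ?thesis by (simp add: z a circle_point_def centre_def mult.assoc)
    qed
    ultimately show "z \<in> quarter_plane" using * by (simp add: quarter_plane_def)
  qed
qed

text \<open>The arc \<open>Arc (-1) 0 D\<close> ends at the origin, so the empty path behaves as if its last step were \<open>D\<close>;
  the step \<open>Db\<close> this would permit at the origin leaves the quarter plane anyway.\<close>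

definition last_arc :: "arc list \<Rightarrow> arc" where
  "last_arc w = last (Arc (-1) 0 D # w)"

lemma last_arc_simps [simp]: "last_arc [] = Arc (-1) 0 D" "last_arc (w @ [a]) = a"
  by (simp_all add: last_arc_def)

lemma path_end_eq: "path_end w = arc_end (last_arc w)"
  by (simp add: path_end_def last_arc_def complex_eq_iff)

section \<open>Extension of paths and completion to the axis\<close>

lemma is_path_Nil [simp]: "is_path []"
  by (simp add: is_path_def)

lemma path_end_in_quarter_plane: "is_path w \<Longrightarrow> path_end w \<in> quarter_plane"
proof (cases "w = []")
  case False
  assume "is_path w"
  moreover have "arc_end (last w) \<in> arc_points (last w)" by (auto simp: arc_end_def arc_points_def)
  ultimately show ?thesis using False by (auto simp: is_path_def path_end_def)
qed (simp add: path_end_def quarter_plane_def)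

text \<open>The start of \<open>a\<close> is the end of \<open>w\<close> and hence already in the
  quarter plane, so containment of the whole arc reduces to the ordinate of its end.\<close>

lemma is_path_snoc:
  "is_path (w @ [a]) \<longleftrightarrow> is_path w \<and> arc_start a = path_end w \<and> 0 \<le> Im (arc_end a)"
proof -
  have "(\<forall>m. Suc m < length (w @ [a]) \<longrightarrow> arc_end ((w @ [a]) ! m) = arc_start ((w @ [a]) ! Suc m)) \<longleftrightarrow>
    (\<forall>m. Suc m < length w \<longrightarrow> arc_end (w ! m) = arc_start (w ! Suc m)) \<and>
    (w \<noteq> [] \<longrightarrow> arc_end (last w) = arc_start a)"
    by (cases w rule: rev_cases) (auto simp: nth_append less_Suc_eq)
  then have "is_path (w @ [a]) \<longleftrightarrow> is_path w \<and> arc_start a = path_end w \<and> arc_points a \<subseteq> quarter_plane"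
    by (cases "w = []") (auto simp: is_path_def path_end_def)
  then show ?thesis
    using path_end_in_quarter_plane[of w] by (auto simp: arc_points_subset_quarter_plane_iff)
qed

lemma ex_height:
  assumes "is_path w"
  obtains k where "has_height w k"
proof -
  obtain k :: int where k: "Im (path_end w) = of_int k * sqrt 3"
  proof -
    obtain i j t where a: "last_arc w = Arc i j t" by (cases "last_arc w")
    show ?thesis
      \<comment> \<open>The centre has height \<open>2 * j\<close>, and every arc ends at that
        height or one unit away from it.\<close>
      using that[of "2 * j - 1"] that[of "2 * j"] that[of "2 * j + 1"]
      by (cases t) (simp_all add: a path_end_eq)
  qed
  with path_end_in_quarter_plane[OF assms] have "0 \<le> k"
    by (simp add: quarter_plane_def zero_le_mult_iff)
  with k have "has_height w (nat k)" by (simp add: has_height_def)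
  then show ?thesis ..
qed

text \<open>Since \<open>l\<close> is a natural number, the last hypothesis also says that the new
  arc does not go below the axis.\<close>

lemma is_path_extend:
  assumes "is_path w" "has_height w k" "follows (arc_type (last_arc w)) t" "int l = int k + height_change t"
  obtains a where "arc_type a = t" "is_path (w @ [a])" "has_height (w @ [a]) l"
proof -
  obtain a where a: "arc_type a = t" "arc_start a = path_end w"
    using assms(3) ex_arc_from_iff[of t "last_arc w"] by (auto simp: path_end_eq)
  have "Im (arc_end a) = of_int (int k + height_change t) * sqrt 3"
    using assms(2) a by (simp add: Im_arc_end has_height_def algebra_simps)
  then have "Im (arc_end a) = real l * sqrt 3" by (simp flip: assms(4))
  then show thesis using that[of a] a assms(1) by (simp add: is_path_snoc has_height_def path_end_def)
qed

lemma packing_path_iff: "packing_path w \<longleftrightarrow> is_path w \<and> has_height w 0"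
  by (simp add: packing_path_def has_height_def)

text \<open>After \<open>U\<close> or \<open>Fb\<close> no descending step is allowed, so an
  \<open>F\<close> is inserted first; after any other type \<open>D\<close> or \<open>Db\<close> is
  available. The extra 1 in the measure pays for that \<open>F\<close>.\<close>

lemma is_path_completable:
  assumes "is_path w" "has_height w k"
  shows "\<exists>v. packing_path (w @ v)"
  using assms
proof (induction "2 * k + (if arc_type (last_arc w) \<in> {U, Fb} then 1 else 0)"
    arbitrary: w k rule: less_induct)
  case less
  show ?case
  proof (cases "k = 0")
    case True
    then show ?thesis using less.prems by (auto simp: packing_path_iff intro!: exI[of _ "[]"])
  next
    case False
    define t where "t = (if arc_type (last_arc w) \<in> {U, Fb} then F
      else if arc_type (last_arc w) \<in> {D, Ub} then Db else D)"
    define l where "l = (if arc_type (last_arc w) \<in> {U, Fb} then k else k - 1)"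
    have "follows (arc_type (last_arc w)) t"
      by (cases "arc_type (last_arc w)") (simp_all add: t_def)
    moreover have "int l = int k + height_change t" using False by (auto simp: t_def l_def)
    ultimately obtain a where a: "arc_type a = t" "is_path (w @ [a])" "has_height (w @ [a]) l"
      by (rule is_path_extend[OF less.prems])
    have "\<exists>v. packing_path ((w @ [a]) @ v)"
      using a False by (intro less.hyps[of l]) (auto simp: t_def l_def)
    then show ?thesis by auto
  qed
qed

lemma is_path_appendD1: "is_path (w @ v) \<Longrightarrow> is_path w"
  by (induction v rule: rev_induct) (auto simp: is_path_snoc simp flip: append_assoc)

lemma partial_packing_path_iff: "partial_packing_path w \<longleftrightarrow> is_path w"
proof
  assume "partial_packing_path w"
  then show "is_path w"
    using is_path_appendD1 by (auto simp: partial_packing_path_def packing_path_iff prefix_def)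
next
  assume w: "is_path w"
  then obtain k where "has_height w k" by (rule ex_height)
  with w show "partial_packing_path w"
    using is_path_completable[of w k] by (auto simp: partial_packing_path_def)
qed

section \<open>Recurrences for the numbers of paths\<close>

lemma partial_paths_eq: "partial_paths n k = {w. is_path w \<and> length w = n \<and> has_height w k}"
  by (simp add: partial_paths_def partial_packing_path_iff)

text \<open>The last arc starts where the shortened path ends, and an arc is determined by its start
  and its type.\<close>

lemma inj_on_path_snoc: "inj_on (\<lambda>w. (butlast w, arc_type (last w))) {w. is_path w \<and> length w = Suc n}"
proof (rule inj_onI)
  fix w v
  assume *: "w \<in> {w. is_path w \<and> length w = Suc n}" "v \<in> {w. is_path w \<and> length w = Suc n}"
    "(butlast w, arc_type (last w)) = (butlast v, arc_type (last v))"
  obtain w' a v' b where wv: "w = w' @ [a]" "v = v' @ [b]"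
    using *(1,2) by (cases w rule: rev_cases; cases v rule: rev_cases) auto
  then show "w = v" using * arc_start_inject[of a b] by (auto simp: is_path_snoc)
qed

lemma UNIV_step: "UNIV = {U, F, D, Ub, Fb, Db}"
  using step.exhaust by auto

lemma finite_paths: "finite {w. is_path w \<and> length w = n}"
proof (induction n)
  case (Suc n)
  have fin: "finite (UNIV :: step set)" by (simp add: UNIV_step)
  have "(\<lambda>w. (butlast w, arc_type (last w))) ` {w. is_path w \<and> length w = Suc n}
    \<subseteq> {w. is_path w \<and> length w = n} \<times> UNIV"
    by (auto simp: length_Suc_conv_rev is_path_snoc)
  then show ?case
    using inj_on_path_snoc Suc fin by (meson finite_SigmaI finite_imageD finite_subset)
qed auto

lemma finite_partial_paths: "finite (partial_paths n k)"
  by (rule finite_subset[OF _ finite_paths[of n]]) (auto simp: partial_paths_eq)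

text \<open>Classifying by \<open>last_arc\<close> rather than \<open>last_step\<close> puts the
  empty path under \<open>D\<close>, so that the recurrences need no exception for it.\<close>

definition path_count :: "nat \<Rightarrow> nat \<Rightarrow> step \<Rightarrow> nat" where
  "path_count n k t = card {w \<in> partial_paths n k. arc_type (last_arc w) = t}"

lemma path_count_0: "path_count 0 k t = (if k = 0 \<and> t = D then 1 else 0)"
proof -
  have "{w \<in> partial_paths 0 k. arc_type (last_arc w) = t} = (if k = 0 \<and> t = D then {[]} else {})"
    by (auto simp: partial_paths_eq has_height_def path_end_def)
  then show ?thesis by (simp add: path_count_def)
qed

lemma has_height_snoc_change:
  assumes "is_path (w @ [a])" "has_height w l" "has_height (w @ [a]) k"
  shows "int k = int l + height_change (arc_type a)"
proof -
  have "real k * sqrt 3 = of_int (int l + height_change (arc_type a)) * sqrt 3"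
    using assms by (simp add: is_path_snoc has_height_def path_end_def Im_arc_end algebra_simps)
  then have "real k = of_int (int l + height_change (arc_type a))" by simp
  then show ?thesis by linarith
qed

text \<open>Removing the last arc is a bijection: the type and the height before it are prescribed,
  and any admissible shorter path extends uniquely.\<close>

lemma path_count_Suc_eq_card:
  assumes "int k = int l + height_change t"
  shows "path_count (Suc n) k t = card {w \<in> partial_paths n l. follows (arc_type (last_arc w)) t}"
proof -
  let ?A = "{w \<in> partial_paths (Suc n) k. arc_type (last_arc w) = t}"
  have "inj_on butlast ?A"
  proof (rule inj_onI)
    fix w v assume *: "w \<in> ?A" "v \<in> ?A" "butlast w = butlast v"
    then have "w \<noteq> []" "v \<noteq> []" by (auto simp: partial_paths_eq)
    show "w = v"
      by (rule inj_onD[OF inj_on_path_snoc[of n]])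
        (use * \<open>w \<noteq> []\<close> \<open>v \<noteq> []\<close> in \<open>auto simp: partial_paths_eq last_arc_def\<close>)
  qed
  moreover have "butlast ` ?A = {w \<in> partial_paths n l. follows (arc_type (last_arc w)) t}"
  proof (intro equalityI subsetI)
    fix v assume "v \<in> butlast ` ?A"
    then obtain a where va: "is_path (v @ [a])" "length v = n" "has_height (v @ [a]) k" "arc_type a = t"
      by (auto simp: partial_paths_eq length_Suc_conv_rev)
    then have v: "is_path v" "arc_start a = path_end v" by (simp_all add: is_path_snoc)
    from v(2) va(4) have "follows (arc_type (last_arc v)) t"
      using ex_arc_from_iff[of t "last_arc v"] by (auto simp: path_end_eq)
    moreover have "has_height v l"
    proof -
      obtain l' where l': "has_height v l'" using ex_height[OF v(1)] .
      from has_height_snoc_change[OF va(1) this va(3)] have "int l' = int l"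
        unfolding va(4) assms by linarith
      with l' show ?thesis by simp
    qed
    ultimately show "v \<in> {w \<in> partial_paths n l. follows (arc_type (last_arc w)) t}"
      using v va by (simp add: partial_paths_eq)
  next
    fix v assume v: "v \<in> {w \<in> partial_paths n l. follows (arc_type (last_arc w)) t}"
    then obtain a where "arc_type a = t" "is_path (v @ [a])" "has_height (v @ [a]) k"
      using is_path_extend[of v l t k] assms by (auto simp: partial_paths_eq)
    then show "v \<in> butlast ` ?A"
      using v by (intro image_eqI[of _ _ "v @ [a]"]) (auto simp: partial_paths_eq)
  qed
  ultimately show ?thesis unfolding path_count_def using card_image by fastforce
qed

lemma card_last_in_two:
  assumes "\<And>t'. follows t' t \<longleftrightarrow> t' = t1 \<or> t' = t2" "t1 \<noteq> t2"
  shows "card {w \<in> partial_paths n l. follows (arc_type (last_arc w)) t} = path_count n l t1 + path_count n l t2"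
proof -
  let ?A = "\<lambda>t'. {w \<in> partial_paths n l. arc_type (last_arc w) = t'}"
  have "{w \<in> partial_paths n l. follows (arc_type (last_arc w)) t} = ?A t1 \<union> ?A t2"
    by (auto simp: assms(1))
  moreover have "finite (?A t1)" "finite (?A t2)" using finite_partial_paths by simp_all
  moreover have "?A t1 \<inter> ?A t2 = {}" using assms(2) by auto
  ultimately show ?thesis by (simp only: path_count_def card_Un_disjoint)
qed

lemma follows_to:
  "follows t U \<longleftrightarrow> t = Ub \<or> t = D"
  "follows t Db \<longleftrightarrow> t = Ub \<or> t = D"
  "follows t F \<longleftrightarrow> t = U \<or> t = Fb"
  "follows t Ub \<longleftrightarrow> t = U \<or> t = Fb"
  "follows t Fb \<longleftrightarrow> t = F \<or> t = Db"
  "follows t D \<longleftrightarrow> t = F \<or> t = Db"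
  by (cases t; simp)+

lemma path_count_Suc_eq:
  assumes "int k = int l + height_change t" "\<And>t'. follows t' t \<longleftrightarrow> t' = t1 \<or> t' = t2" "t1 \<noteq> t2"
  shows "path_count (Suc n) k t = path_count n l t1 + path_count n l t2"
  by (simp only: path_count_Suc_eq_card[OF assms(1)] card_last_in_two[OF assms(2,3)])

text \<open>The boundary case: an ascending last step to height 0 would start at height -1.\<close>

lemma path_count_Suc_0: 
  assumes "height_change t = 1"
  shows "path_count (Suc n) 0 t = 0"
proof -
  have False if w: "w \<in> partial_paths (Suc n) 0" "arc_type (last_arc w) = t" for w
  proof -
    from w obtain v a where va: "is_path (v @ [a])" "has_height (v @ [a]) 0" "arc_type a = t"
      by (auto simp: partial_paths_eq length_Suc_conv_rev)
    have "is_path v" using va(1) by (simp add: is_path_snoc)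
    then obtain l where "has_height v l" by (rule ex_height)
    from has_height_snoc_change[OF va(1) this va(2)] show False
      unfolding va(3) assms by linarith
  qed
  then have "{w \<in> partial_paths (Suc n) 0. arc_type (last_arc w) = t} = {}" by blast
  then show ?thesis unfolding path_count_def by (simp only: card.empty)
qed

lemma path_count_Suc:
  "path_count (Suc n) (Suc k) U = path_count n k Ub + path_count n k D"
  "path_count (Suc n) (Suc k) Ub = path_count n k U + path_count n k Fb"
  "path_count (Suc n) 0 U = 0"
  "path_count (Suc n) 0 Ub = 0"
  "path_count (Suc n) k F = path_count n k U + path_count n k Fb"
  "path_count (Suc n) k Fb = path_count n k F + path_count n k Db"
  "path_count (Suc n) k D = path_count n (Suc k) F + path_count n (Suc k) Db"
  "path_count (Suc n) k Db = path_count n (Suc k) Ub + path_count n (Suc k) D"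
proof goal_cases
  case 3 show ?case by (rule path_count_Suc_0) simp
next
  case 4 show ?case by (rule path_count_Suc_0) simp
qed (rule path_count_Suc_eq; simp add: follows_to)+

text \<open>The two classifications disagree only on the empty path.\<close>

lemma card_last_step:
  "card {w \<in> partial_paths n k. last_step w = t} =
     (if n = 0 then (if k = 0 \<and> t = U then 1 else 0) else path_count n k t)"
proof (cases "n = 0")
  case True
  then have "{w \<in> partial_paths n k. last_step w = t} = (if k = 0 \<and> t = U then {[]} else {})"
    by (auto simp: partial_paths_eq has_height_def path_end_def last_step_def)
  then show ?thesis using True by simp
next
  case False
  then have "{w \<in> partial_paths n k. last_step w = t} = {w \<in> partial_paths n k. arc_type (last_arc w) = t}"
    by (auto simp: partial_paths_eq last_step_def last_arc_def)
  then show ?thesis using False by (simp add: path_count_def)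
qed

section \<open>The power series r and its quadratic equation\<close>

abbreviation x_fps :: "real fps" where "x_fps \<equiv> fps_X"

text \<open>The shift realises division by \<open>x^2\<close>, as the coefficients of degree 0 and 1
  of the numerator vanish.\<close>

definition r_fps :: "real fps" where
  "r_fps = fps_const (1/2) * fps_shift 2 (1 - 2 * fps_X ^ 3 - fps_X ^ 2 - fps_radical root 2 Delta)"

lemma Delta_nth: "fps_nth Delta 0 = 1" "fps_nth Delta (Suc 0) = 0"
  by (simp_all add: Delta_def numeral_fps_const fps_X_power_nth)

lemma sqrt_Delta_power2: "fps_radical root 2 Delta ^ 2 = Delta"
  using power_radical[of Delta root 1] by (simp add: Delta_nth numeral_2_eq_2)

lemma sqrt_Delta_nth: "fps_nth (fps_radical root 2 Delta) 0 = 1" "fps_nth (fps_radical root 2 Delta) (Suc 0) = 0"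
proof -
  show 0: "fps_nth (fps_radical root 2 Delta) 0 = 1" by (simp add: Delta_nth)
  \<comment> \<open>The linear coefficient of the square is twice that of the root, whose constant
    term is 1.\<close>
  have "fps_nth (fps_radical root 2 Delta ^ 2) (Suc 0) = 0" by (simp add: sqrt_Delta_power2 Delta_nth)
  then show "fps_nth (fps_radical root 2 Delta) (Suc 0) = 0"
    by (simp add: power2_eq_square fps_mult_nth Delta_nth)
qed

lemma r_fps_times: "2 * x_fps ^ 2 * r_fps = 1 - 2 * x_fps ^ 3 - x_fps ^ 2 - fps_radical root 2 Delta"
proof -
  let ?N = "1 - 2 * x_fps ^ 3 - x_fps ^ 2 - fps_radical root 2 Delta"
  have "fps_shift 2 ?N * fps_X ^ 2 = ?N"
  proof (rule fps_ext)
    fix n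
    show "fps_nth (fps_shift 2 ?N * fps_X ^ 2) n = fps_nth ?N n"
    proof (cases "n < 2")
      case True
      then show ?thesis
        by (auto simp: fps_X_power_mult_right_nth numeral_fps_const sqrt_Delta_nth less_2_cases_iff
            simp del: fps_radical_nth_0)
    next
      case False
      then obtain m where "n = m + 2" by (metis add.commute le_Suc_ex not_less)
      then show ?thesis by (simp add: fps_X_power_mult_right_nth)
    qed
  qed
  moreover have "2 * x_fps ^ 2 * r_fps = (2 * fps_const (1/2)) * (fps_shift 2 ?N * fps_X ^ 2)"
    unfolding r_fps_def by (simp only: ac_simps)
  moreover have "2 * fps_const (1/2) = (1 :: real fps)"
    by (simp add: numeral_fps_const)
  ultimately show ?thesis by (simp only: mult_1)
qed

text \<open>Squaring removes the radical, and
  \<open>(1 - 2x^3 - x^2)^2 - Delta = 4x^4\<close>.\<close>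

lemma r_fps_quadratic: "x_fps ^ 2 * r_fps ^ 2 + x_fps ^ 2 = (1 - 2 * x_fps ^ 3 - x_fps ^ 2) * r_fps"
proof -
  have "(1 - 2 * x_fps ^ 3 - x_fps ^ 2 - 2 * x_fps ^ 2 * r_fps) ^ 2 = Delta"
    by (simp add: r_fps_times sqrt_Delta_power2)
  then have "4 * x_fps ^ 2 * (x_fps ^ 2 * r_fps ^ 2 + x_fps ^ 2) =
      4 * x_fps ^ 2 * ((1 - 2 * x_fps ^ 3 - x_fps ^ 2) * r_fps)"
    unfolding Delta_def by algebra
  then show ?thesis by (simp del: distrib_left_numeral)
qed

lemma r_series_eq: "r_series = fps_to_fls r_fps"
proof -
  have "2 * fls_X ^ 2 * fps_to_fls r_fps = 1 - 2 * fls_X ^ 3 - fls_X ^ 2 - sqrt_Delta"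
    using arg_cong[OF r_fps_times, of fps_to_fls]
    by (simp add: fls_times_fps_to_fls fps_to_fls_power sqrt_Delta_def)
  then show ?thesis by (simp add: r_series_def field_simps)
qed

lemma r_plus_s: "fls_X ^ 2 * (r_series + s_series) = 1 - 2 * fls_X ^ 3 - fls_X ^ 2"
  by (simp add: r_series_def s_series_def field_simps)

text \<open>Multiplying the formula for \<open>r + s\<close> by \<open>r\<close> and comparing with
  the quadratic equation leaves \<open>x^2 * r * s = x^2\<close>.\<close>

lemma r_times_s: "r_series * s_series = 1"
proof -
  have "fls_X ^ 2 * r_series ^ 2 + fls_X ^ 2 = (1 - 2 * fls_X ^ 3 - fls_X ^ 2) * r_series"
    using arg_cong[OF r_fps_quadratic, of fps_to_fls]
    by (simp add: r_series_eq fls_times_fps_to_fls fps_to_fls_power)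
  then have "fls_X ^ 2 * (r_series * s_series) = fls_X ^ 2 * 1"
    using r_plus_s by algebra
  then show ?thesis by simp
qed

section \<open>Solving the recurrences with powers of r\<close>

definition U_factor :: "real fps" where
  "U_factor = (x_fps + r_fps) * inverse (1 + x_fps)"

text \<open>One factor serves \<open>D\<close> at height 0 (empty path excluded) and
  \<open>Fb\<close> at height 1, since both steps follow \<open>F\<close> or \<open>Db\<close> at
  height 1.\<close>

definition D_factor :: "real fps" where
  "D_factor = r_fps * (2 * x_fps ^ 2 + x_fps + r_fps * x_fps) * inverse (1 + x_fps)"

definition Db_factor :: "real fps" where
  "Db_factor = r_fps * (r_fps + x_fps) * inverse (1 + x_fps)"

lemma one_plus_x_inverse: "(1 + x_fps) * inverse (1 + x_fps) = 1"
  by (subst mult.commute) (simp add: inverse_mult_eq_1)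

lemma factors_times:
  "(1 + x_fps) * U_factor = x_fps + r_fps"
  "(1 + x_fps) * D_factor = r_fps * (2 * x_fps ^ 2 + x_fps + r_fps * x_fps)"
  "(1 + x_fps) * Db_factor = r_fps * (r_fps + x_fps)"
  using one_plus_x_inverse unfolding U_factor_def D_factor_def Db_factor_def by algebra+

lemma one_plus_x_nonzero: "1 + x_fps \<noteq> 0"
  using one_plus_x_inverse by force

text \<open>These are the recurrences at height 1, where \<open>U_factor\<close>,
  \<open>r_fps\<close>, \<open>D_factor\<close>, \<open>Db_factor\<close> belong to
  \<open>U\<close>, \<open>F\<close>, \<open>Fb\<close>, \<open>Db\<close>. After multiplication by
  \<open>1 + x\<close> they follow from the quadratic equation.\<close>

lemma factor_recurrences:
  "U_factor = x_fps * (1 + D_factor)"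
  "r_fps = x_fps * (U_factor + D_factor)"
  "D_factor = x_fps * (r_fps + Db_factor)"
  "Db_factor = x_fps * (r_fps + r_fps * D_factor)"
proof -
  have "(1 + x_fps) * U_factor = (1 + x_fps) * (x_fps * (1 + D_factor))"
    "(1 + x_fps) * r_fps = (1 + x_fps) * (x_fps * (U_factor + D_factor))"
    "(1 + x_fps) * D_factor = (1 + x_fps) * (x_fps * (r_fps + Db_factor))"
    "(1 + x_fps) * Db_factor = (1 + x_fps) * (x_fps * (r_fps + r_fps * D_factor))"
    using factors_times r_fps_quadratic by algebra+
  then show
    "U_factor = x_fps * (1 + D_factor)"
    "r_fps = x_fps * (U_factor + D_factor)"
    "D_factor = x_fps * (r_fps + Db_factor)"
    "Db_factor = x_fps * (r_fps + r_fps * D_factor)"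
    by (simp_all only: mult_left_cancel[OF one_plus_x_nonzero])
qed

text \<open>The summand 1 at \<open>D\<close> accounts for the empty path, which \<open>path_count\<close> assigns to \<open>D\<close>.\<close>

fun height_gf :: "step \<Rightarrow> nat \<Rightarrow> real fps" where
  "height_gf U k = (if odd k then r_fps ^ (k div 2) * U_factor else 0)"
| "height_gf F k = (if odd k then r_fps ^ (k div 2) * r_fps else 0)"
| "height_gf Fb k = (if odd k then r_fps ^ (k div 2) * D_factor else 0)"
| "height_gf Db k = (if odd k then r_fps ^ (k div 2) * Db_factor else 0)"
| "height_gf Ub k = (if even k \<and> k \<noteq> 0 then r_fps ^ (k div 2) else 0)"
| "height_gf D k = (if even k then r_fps ^ (k div 2) * D_factor else 0) + (if k = 0 then 1 else 0)"

lemma height_gf_rec: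
  "height_gf U (Suc k) = x_fps * (height_gf Ub k + height_gf D k)"
  "height_gf Ub (Suc k) = x_fps * (height_gf U k + height_gf Fb k)"
  "height_gf U 0 = 0"
  "height_gf Ub 0 = 0"
  "height_gf F k = x_fps * (height_gf U k + height_gf Fb k)"
  "height_gf Fb k = x_fps * (height_gf F k + height_gf Db k)"
  "height_gf D k = (if k = 0 then 1 else 0) + x_fps * (height_gf F (Suc k) + height_gf Db (Suc k))"
  "height_gf Db k = x_fps * (height_gf Ub (Suc k) + height_gf D (Suc k))"
proof -
  \<comment> \<open>Raising the height by two multiplies by \<open>r_fps\<close>, so
    \<open>p\<close> will be a power of it.\<close>
  have *: "p * U_factor = x_fps * (p + p * D_factor)"
    "p * r_fps = x_fps * (p * U_factor + p * D_factor)"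
    "p * D_factor = x_fps * (p * r_fps + p * Db_factor)"
    "p * Db_factor = x_fps * (p * r_fps + p * r_fps * D_factor)" for p
    using factor_recurrences by algebra+
  show
    "height_gf U (Suc k) = x_fps * (height_gf Ub k + height_gf D k)"
    using *(1)[of "r_fps ^ (k div 2)"] by (cases "k = 0") (auto simp: algebra_simps)
  show "height_gf Ub (Suc k) = x_fps * (height_gf U k + height_gf Fb k)"
    using *(2)[of "r_fps ^ (k div 2)"] by (auto elim!: oddE simp: mult.commute)
  show "height_gf U 0 = 0" "height_gf Ub 0 = 0" by simp_all
  show "height_gf F k = x_fps * (height_gf U k + height_gf Fb k)"
    using *(2)[of "r_fps ^ (k div 2)"] by auto
  show "height_gf Fb k = x_fps * (height_gf F k + height_gf Db k)"
    using *(3)[of "r_fps ^ (k div 2)"] by auto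
  show "height_gf D k = (if k = 0 then 1 else 0) + x_fps * (height_gf F (Suc k) + height_gf Db (Suc k))"
    using *(3)[of "r_fps ^ (k div 2)"] by auto
  show "height_gf Db k = x_fps * (height_gf Ub (Suc k) + height_gf D (Suc k))"
    using *(4)[of "r_fps ^ (k div 2)"] by (auto elim!: oddE simp: mult.commute)
qed

text \<open>Both sides obey the same recurrences; the factor \<open>x_fps\<close> makes degree
  \<open>Suc n\<close> depend on degree \<open>n\<close> only.\<close>

lemma path_count_eq: "real (path_count n k t) = fps_nth (height_gf t k) n"
proof (induction n arbitrary: k t)
  case 0
  show ?case
    by (cases t; cases k; simp only: path_count_0; subst height_gf_rec; simp del: height_gf.simps)
next
  case (Suc n)
  show ?case
    by (cases t; cases k; simp only: path_count_Suc; subst height_gf_rec; simp add: Suc del: height_gf.simps)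
qed

text \<open>The correction moves the empty path from \<open>D\<close> to \<open>U\<close>.\<close>

lemma gf_height_eq:
  "gf_height t k = height_gf t k + (if k = 0 then (if t = U then 1 else if t = D then -1 else 0) else 0)"
  by (rule fps_ext)
    (auto simp: gf_height_def card_last_step path_count_0 simp del: height_gf.simps simp flip: path_count_eq)

section \<open>Summation over all heights\<close>

lemma S_nth: "fps_nth S k = fps_to_fls (Abs_fps (\<lambda>n. of_nat (card (partial_paths n k))))"
proof -
  have "card (partial_paths n k) = (\<Sum>t\<in>UNIV. card {w \<in> partial_paths n k. last_step w = t})" for n
  proof -
    have "partial_paths n k = (\<Union>t\<in>UNIV. {w \<in> partial_paths n k. last_step w = t})" by auto
    also have "card \<dots> = (\<Sum>t\<in>UNIV. card {w \<in> partial_paths n k. last_step w = t})"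
      by (rule card_UN_disjoint) (auto simp: finite_partial_paths UNIV_step)
    finally show ?thesis .
  qed
  then have "Abs_fps (\<lambda>n. real (card (partial_paths n k))) =
    gf_height U k + gf_height Ub k + gf_height D k + gf_height Db k + gf_height F k + gf_height Fb k"
    by (intro fps_ext) (simp add: gf_height_def UNIV_step)
  then show ?thesis by (simp add: S_def GF_def)
qed

text \<open>The expansion of \<open>1 / (1 - r * u^2)\<close>, which is
  \<open>- s / (u^2 - s)\<close> because \<open>r * s = 1\<close>.\<close>

definition even_powers :: "real fls fps" where
  "even_powers = Abs_fps (\<lambda>k. if even k then r_series ^ (k div 2) else 0)"

lemma even_powers_times: "even_powers * (1 - fps_const r_series * fps_X ^ 2) = 1"
proof (rule fps_ext)
  fix n
  have "fps_nth (even_powers - fps_const r_series * (fps_X ^ 2 * even_powers)) n = fps_nth 1 n"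
  proof (cases "n < 2")
    case True
    then show ?thesis by (auto simp: less_2_cases_iff even_powers_def fps_X_power_mult_nth)
  next
    case False
    then obtain m where "n = m + 2" by (metis add.commute le_Suc_ex not_less)
    then show ?thesis by (simp add: even_powers_def fps_X_power_mult_nth)
  qed
  then show "fps_nth (even_powers * (1 - fps_const r_series * fps_X ^ 2)) n = fps_nth 1 n"
    by (simp add: algebra_simps)
qed

lemma GF_eq:
  "GF U = 1 + fps_const (fps_to_fls U_factor) * (fps_X * even_powers)"
  "GF Ub = fps_const r_series * (fps_X ^ 2 * even_powers)"
  "GF D = fps_const (fps_to_fls D_factor) * even_powers"
  "GF Db = fps_const (fps_to_fls Db_factor) * (fps_X * even_powers)"
  "GF F = fps_const r_series * (fps_X * even_powers)"
  "GF Fb = fps_const (fps_to_fls D_factor) * (fps_X * even_powers)"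
proof -
  note simps = GF_def gf_height_eq even_powers_def fps_X_mult_nth fps_X_power_mult_nth
    fls_times_fps_to_fls fps_to_fls_power r_series_eq
  show "GF U = 1 + fps_const (fps_to_fls U_factor) * (fps_X * even_powers)"
    by (rule fps_ext) (auto simp: simps elim!: oddE)
  show "GF Ub = fps_const r_series * (fps_X ^ 2 * even_powers)"
  proof (rule fps_ext)
    fix k
    show "fps_nth (GF Ub) k = fps_nth (fps_const r_series * (fps_X ^ 2 * even_powers)) k"
    proof (cases "k < 2")
      case False
      then obtain m where "k = m + 2" by (metis add.commute le_Suc_ex not_less)
      then show ?thesis by (auto simp: simps)
    qed (auto simp: simps less_2_cases_iff)
  qed
  show "GF D = fps_const (fps_to_fls D_factor) * even_powers"
    by (rule fps_ext) (auto simp: simps)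
  show "GF Db = fps_const (fps_to_fls Db_factor) * (fps_X * even_powers)"
    by (rule fps_ext) (auto simp: simps elim!: oddE)
  show "GF F = fps_const r_series * (fps_X * even_powers)"
    by (rule fps_ext) (auto simp: simps elim!: oddE)
  show "GF Fb = fps_const (fps_to_fls D_factor) * (fps_X * even_powers)"
    by (rule fps_ext) (auto simp: simps elim!: oddE)
qed

theorem theorem4:
  fixes x u r s :: "real fls fps"
  assumes "x = fps_const fls_X"
    and "u = fps_X"
    and "r = fps_const r_series"
    and "s = fps_const s_series"
  shows "GF U = 1 - u * (x * s + 1) / ((x + 1) * (u ^ 2 - s))
    \<and> GF Ub = - (u ^ 2) / (u ^ 2 - s)
    \<and> GF D = (- 2 * x ^ 2 - (1 + r) * x) / ((1 + x) * (u ^ 2 - s))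
    \<and> GF Db = - u * (r + x) / ((1 + x) * (u ^ 2 - s))
    \<and> GF F = - u / (u ^ 2 - s)
    \<and> GF Fb = u * (- 2 * x ^ 2 - (1 + r) * x) / ((1 + x) * (u ^ 2 - s))
    \<and> (\<forall>k. fps_nth S k = fps_to_fls (Abs_fps (\<lambda>n. of_nat (card (partial_paths n k)))))
    \<and> S = (u * (- 2 * x ^ 2 - x * (r + 2) - 1) - s * x - 1) / (x * (1 + x) * (u ^ 2 - s))"
proof -
  define E where "E = even_powers"
  define a where "a = fps_const (fps_to_fls U_factor)"
  define d where "d = fps_const (fps_to_fls D_factor)"
  define b where "b = fps_const (fps_to_fls Db_factor)"
  note GF = GF_eq[folded E_def a_def d_def b_def assms(2,3)]
  have rs: "r * s = 1"
    by (simp add: assms r_times_s)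
  have rps: "x ^ 2 * (r + s) = 1 - 2 * x ^ 3 - x ^ 2"
    using arg_cong[OF r_plus_s, of fps_const]
    by (simp add: assms fps_const_power numeral_fps_const)
  have fac: "(1 + x) * a = x + r" "(1 + x) * d = r * (2 * x ^ 2 + x + r * x)" "(1 + x) * b = r * (r + x)"
    using factors_times[THEN arg_cong, of "\<lambda>f. fps_const (fps_to_fls f)"]
    by (simp_all add: assms a_def d_def b_def r_series_eq fls_times_fps_to_fls fps_to_fls_power
        fps_const_power numeral_fps_const flip: fps_const_1_eq_1)
  have E: "E * (u ^ 2 - s) = - s"
    using even_powers_times[folded E_def assms(2,3)] rs by algebra
  have w: "u ^ 2 - s \<noteq> 0"
    using E rs by force
  \<comment> \<open>As a series in \<open>u\<close>, \<open>1 + x\<close> is the constant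
    \<open>1 + fls_X\<close>.\<close>
  have "fps_nth (1 + x) 0 \<noteq> 0"
    by (simp add: assms fls_eq_iff) (metis)
  then have x1: "1 + x \<noteq> 0" by force
  have x0: "x \<noteq> 0" by (simp add: assms)
  \<comment> \<open>Series in \<open>u\<close> do not form a field, but a product identity with a
    nonzero divisor determines the quotient; hence each fraction is proved by clearing its
    denominator.\<close>
  have divI: "f = g / h" if "f * h = g" "h \<noteq> 0" for f g h :: "real fls fps"
    using that nonzero_mult_div_cancel_right[of h f] by simp
  define w where "w = u ^ 2 - s"
  have Ew: "E * w = - s" using E by (simp add: w_def)
  have mult: "(1 - GF U) * ((x + 1) * w) = u * (x * s + 1)"
    "GF Ub * w = - (u ^ 2)"
    "GF D * ((1 + x) * w) = - 2 * x ^ 2 - (1 + r) * x"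
    "GF Db * ((1 + x) * w) = - u * (r + x)"
    "GF F * w = - u"
    "GF Fb * ((1 + x) * w) = u * (- 2 * x ^ 2 - (1 + r) * x)"
  proof -
    have "(1 - GF U) * ((x + 1) * w) = - u * ((1 + x) * a) * (E * w)"
      unfolding GF by (simp add: algebra_simps)
    then show "(1 - GF U) * ((x + 1) * w) = u * (x * s + 1)"
      unfolding fac Ew using rs by algebra
    have "GF Ub * w = r * u ^ 2 * (E * w)"
      unfolding GF by (simp add: algebra_simps)
    then show "GF Ub * w = - (u ^ 2)"
      unfolding Ew using rs by algebra
    have "GF D * ((1 + x) * w) = ((1 + x) * d) * (E * w)"
      unfolding GF by (simp add: algebra_simps)
    then show "GF D * ((1 + x) * w) = - 2 * x ^ 2 - (1 + r) * x"
      unfolding fac Ew using rs by algebra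
    have "GF Db * ((1 + x) * w) = u * ((1 + x) * b) * (E * w)"
      unfolding GF by (simp add: algebra_simps)
    then show "GF Db * ((1 + x) * w) = - u * (r + x)"
      unfolding fac Ew using rs by algebra
    have "GF F * w = r * u * (E * w)"
      unfolding GF by (simp add: algebra_simps)
    then show "GF F * w = - u"
      unfolding Ew using rs by algebra
    have "GF Fb * ((1 + x) * w) = u * ((1 + x) * d) * (E * w)"
      unfolding GF by (simp add: algebra_simps)
    then show "GF Fb * ((1 + x) * w) = u * (- 2 * x ^ 2 - (1 + r) * x)"
      unfolding fac Ew using rs by algebra
  qed
  \<comment> \<open>Arranged so that the six products in \<open>mult\<close> occur literally; the
    formula for \<open>r + s\<close> then gives the claimed numerator.\<close>
  have "S * (x * (1 + x) * w) = x * ((1 + x) * w - (1 - GF U) * ((x + 1) * w) + (1 + x) * (GF Ub * w)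
      + GF D * ((1 + x) * w) + GF Db * ((1 + x) * w) + (1 + x) * (GF F * w) + GF Fb * ((1 + x) * w))"
    unfolding S_def by (simp add: algebra_simps)
  also have "\<dots> = u * (- 2 * x ^ 2 - x * (r + 2) - 1) - s * x - 1"
    unfolding mult unfolding w_def using rps by algebra
  finally have multS: "S * (x * (1 + x) * w) = u * (- 2 * x ^ 2 - x * (r + 2) - 1) - s * x - 1" .
  have nz: "w \<noteq> 0" "(1 + x) * w \<noteq> 0" "(x + 1) * w \<noteq> 0" "x * (1 + x) * w \<noteq> 0"
    using w x1 x0 by (simp_all add: w_def add.commute)
  have U: "1 - GF U = u * (x * s + 1) / ((x + 1) * w)"
    by (rule divI[OF mult(1) nz(3)])
  then have "GF U = 1 - u * (x * s + 1) / ((x + 1) * w)"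
    by (simp add: eq_diff_eq diff_eq_eq add.commute)
  then show ?thesis
    using divI[OF mult(2) nz(1)] divI[OF mult(3) nz(2)] divI[OF mult(4) nz(2)] divI[OF mult(5) nz(1)]
      divI[OF mult(6) nz(2)] divI[OF multS nz(4)] S_nth
    unfolding w_def by blast
qed

end
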